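(* Let $\Omega\subset\mathbb{R}^n$ be an open set, $s\in(0,1)$, $q\in\mathcal{P}(\Omega)$ and $p\in\mathcal{P}(\Omega\times\Omega)$, with $1<q^-\le q^+<\infty$ and $1<p^-\le p^+<\infty$. Then the space $\mathcal{W}^{s,q(\cdot),p(\cdot,\cdot)}_{0}(\Omega)$ is a closed ideal in $\mathcal{W}^{s,q(\cdot),p(\cdot,\cdot)}(\Omega)$.
   Context: Exponents: $\mathcal{P}(\Omega)$ is the set of measurable functions $q:\Omega\to[1,\infty)$, $\mathcal{P}(\Omega\times\Omega)$ the set of measurable functions $p:\Omega\times\Omega\to[1,\infty)$; $q^-,q^+$ and $p^-,p^+$ denote the essential infimum and supremum of $q$ on $\Omega$ and of $p$ on $\Omega\times\Omega$. Modular: for measurable $u:\Omega\to\mathbb{R}$, $$\rho^{s,\Omega}_{q(\cdot),p(\cdot,\cdot)}(u)=\int_\Omega |u(x)|^{q(x)}\,dx+\int_\Omega\int_\Omega \frac{|u(x)-u(y)|^{p(x,y)}}{|x-y|^{n+sp(x,y)}}\,dx\,dy .$$ $\mathcal{W}^{s,q(\cdot),p(\cdot,\cdot)}(\Omega)$ is the space of (a.e. classes of) measurable $u$ with $\rho^{s,\Omega}_{q(\cdot),p(\cdot,\cdot)}(u)<\infty$. Its norm is $\|u\|=\|u\|_{L^{q(\cdot)}(\Omega)}+[u]$, where $\|u\|_{L^{q(\cdot)}(\Omega)}=\inf\{\lambda>0:\int_\Omega|u(x)/\lambda|^{q(x)}dx\le1\}$ and $[u]=\inf\{\lambda>0:\int_\Omega\int_\Omega\frac{|u(x)-u(y)|^{p(x,y)}}{\lambda^{p(x,y)}|x-y|^{n+sp(x,y)}}dx\,dy\le1\}$.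 $\mathcal{W}^{s,q(\cdot),p(\cdot,\cdot)}_{0}(\Omega)$ is the closure in $\mathcal{W}^{s,q(\cdot),p(\cdot,\cdot)}(\Omega)$ of the set $\{u\in\mathcal{W}^{s,q(\cdot),p(\cdot,\cdot)}(\Omega): u=u\chi_K \text{ for some compact } K\subset\Omega\}$. A subspace $I$ of $\mathcal{W}^{s,q(\cdot),p(\cdot,\cdot)}(\Omega)$ is an ideal if $u\in I$, $v\in\mathcal{W}^{s,q(\cdot),p(\cdot,\cdot)}(\Omega)$ and $|v|\le|u|$ a.e. imply $v\in I$. *)

theory Defs
  imports "HOL-Analysis.Analysis" "HOL-Probability.Essential_Supremum"
begin

text \<open>Variable exponents on a measure space, with values in \<open>[1, \<infinity>)\<close>; the measure is
  \<open>lebesgue_on \<Omega>\<close> or \<open>lebesgue_on (\<Omega> \<times> \<Omega>)\<close> below.\<close>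

definition exponents :: "'a measure \<Rightarrow> ('a \<Rightarrow> real) set" where
  "exponents M = {r \<in> borel_measurable M. \<forall>x\<in>space M. 1 \<le> r x}"

text \<open>The library only has the essential supremum \<open>esssup\<close>.\<close>

definition essinf :: "'a measure \<Rightarrow> ('a \<Rightarrow> ereal) \<Rightarrow> ereal" where
  "essinf M f = Sup {z. AE x in M. z \<le> f x}"

definition lq_modular ::
  "(real^'n) set \<Rightarrow> (real^'n \<Rightarrow> real) \<Rightarrow> (real^'n \<Rightarrow> real) \<Rightarrow> ennreal" where
  "lq_modular \<Omega> q u = (\<integral>\<^sup>+x. ennreal (\<bar>u x\<bar> powr q x) \<partial>lebesgue_on \<Omega>)"

text \<open>The Gagliardo double integral with the additional factor \<open>1 / t\<^bsup>p(x,y)\<^esup>\<close>; it is taken with respect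
  to Lebesgue measure on the product, which for the jointly measurable, nonnegative integrand
  agrees with the iterated integral by Tonelli's theorem. On the null set \<open>x = y\<close> the
  integrand is \<open>0 / 0 = 0\<close>.\<close>

definition gagliardo ::
  "(real^'n) set \<Rightarrow> real \<Rightarrow> ((real^'n) \<times> (real^'n) \<Rightarrow> real) \<Rightarrow> real \<Rightarrow> (real^'n \<Rightarrow> real) \<Rightarrow> ennreal" where
  "gagliardo \<Omega> s p t u =
    (\<integral>\<^sup>+(x, y). ennreal (\<bar>u x - u y\<bar> powr p (x, y) /
        (t powr p (x, y) * norm (x - y) powr (real CARD('n) + s * p (x, y))))
      \<partial>lebesgue_on (\<Omega> \<times> \<Omega>))"

definition modular ::
  "(real^'n) set \<Rightarrow> real \<Rightarrow> (real^'n \<Rightarrow> real) \<Rightarrow> ((real^'n) \<times> (real^'n) \<Rightarrow> real)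
    \<Rightarrow> (real^'n \<Rightarrow> real) \<Rightarrow> ennreal" where
  "modular \<Omega> s q p u = lq_modular \<Omega> q u + gagliardo \<Omega> s p 1 u"

text \<open>Elements of the space are represented by functions on all of \<open>real^'n\<close>, of which only
  the restriction to \<open>\<Omega>\<close>, up to a.e. equality, matters: every notion below is invariant under a.e.
  equality on \<open>\<Omega>\<close>, so no passage to equivalence classes is made. Correspondingly, \<open>W_norm\<close>
  is a norm modulo a.e. equality on \<open>\<Omega>\<close>.\<close>

definition W_space ::
  "(real^'n) set \<Rightarrow> real \<Rightarrow> (real^'n \<Rightarrow> real) \<Rightarrow> ((real^'n) \<times> (real^'n) \<Rightarrow> real)
    \<Rightarrow> (real^'n \<Rightarrow> real) set" where
  "W_space \<Omega> s q p = {u \<in> borel_measurable (lebesgue_on \<Omega>). modular \<Omega> s q p u < \<infinity>}"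

definition lq_norm ::
  "(real^'n) set \<Rightarrow> (real^'n \<Rightarrow> real) \<Rightarrow> (real^'n \<Rightarrow> real) \<Rightarrow> real" where
  "lq_norm \<Omega> q u = Inf {t. 0 < t \<and> lq_modular \<Omega> q (\<lambda>x. u x / t) \<le> 1}"

definition gagliardo_seminorm ::
  "(real^'n) set \<Rightarrow> real \<Rightarrow> ((real^'n) \<times> (real^'n) \<Rightarrow> real) \<Rightarrow> (real^'n \<Rightarrow> real) \<Rightarrow> real" where
  "gagliardo_seminorm \<Omega> s p u = Inf {t. 0 < t \<and> gagliardo \<Omega> s p t u \<le> 1}"

definition W_norm ::
  "(real^'n) set \<Rightarrow> real \<Rightarrow> (real^'n \<Rightarrow> real) \<Rightarrow> ((real^'n) \<times> (real^'n) \<Rightarrow> real)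
    \<Rightarrow> (real^'n \<Rightarrow> real) \<Rightarrow> real" where
  "W_norm \<Omega> s q p u = lq_norm \<Omega> q u + gagliardo_seminorm \<Omega> s p u"

text \<open>The topology on a set of functions \<open>V\<close> induced by a (semi)norm \<open>N\<close>.\<close>

definition norm_topology ::
  "('a \<Rightarrow> real) set \<Rightarrow> (('a \<Rightarrow> real) \<Rightarrow> real) \<Rightarrow> ('a \<Rightarrow> real) topology" where
  "norm_topology V N = topology (\<lambda>U. U \<subseteq> V \<and>
     (\<forall>u\<in>U. \<exists>e>0. \<forall>v\<in>V. N (\<lambda>x. v x - u x) < e \<longrightarrow> v \<in> U))"

lemma openin_norm_topology:
  "openin (norm_topology V N) U \<longleftrightarrow>
     U \<subseteq> V \<and> (\<forall>u\<in>U. \<exists>e>0. \<forall>v\<in>V. N (\<lambda>x. v x - u x) < e \<longrightarrow> v \<in> U)"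
proof -
  let ?P = "\<lambda>U. U \<subseteq> V \<and> (\<forall>u\<in>U. \<exists>e>0. \<forall>v\<in>V. N (\<lambda>x. v x - u x) < e \<longrightarrow> v \<in> U)"
  have "istopology ?P"
    unfolding istopology_def
  proof (intro conjI allI impI)
    fix S T assume S: "?P S" and T: "?P T"
    show "S \<inter> T \<subseteq> V" using S by blast
    show "\<forall>u\<in>S \<inter> T. \<exists>e>0. \<forall>v\<in>V. N (\<lambda>x. v x - u x) < e \<longrightarrow> v \<in> S \<inter> T"
    proof
      fix u assume u: "u \<in> S \<inter> T"
      obtain d where d: "d > 0" "\<forall>v\<in>V. N (\<lambda>x. v x - u x) < d \<longrightarrow> v \<in> S"
        using S u by blast
      obtain e where e: "e > 0" "\<forall>v\<in>V. N (\<lambda>x. v x - u x) < e \<longrightarrow> v \<in> T"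
        using T u by blast
      show "\<exists>e>0. \<forall>v\<in>V. N (\<lambda>x. v x - u x) < e \<longrightarrow> v \<in> S \<inter> T"
        using d e by (intro exI[of _ "min d e"]) auto
    qed
  next
    fix \<K> assume "\<forall>K\<in>\<K>. ?P K"
    then show "\<Union>\<K> \<subseteq> V"
      and "\<forall>u\<in>\<Union>\<K>. \<exists>e>0. \<forall>v\<in>V. N (\<lambda>x. v x - u x) < e \<longrightarrow> v \<in> \<Union>\<K>"
      by (blast, meson UnionE UnionI)
  qed
  then show ?thesis
    unfolding norm_topology_def by (simp add: topology_inverse')
qed

lemma topspace_norm_topology [simp]: "topspace (norm_topology V N) = V"
  unfolding topspace_def openin_norm_topology by (auto intro: zero_less_one)

definition W_topology ::
  "(real^'n) set \<Rightarrow> real \<Rightarrow> (real^'n \<Rightarrow> real) \<Rightarrow> ((real^'n) \<times> (real^'n) \<Rightarrow> real)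
    \<Rightarrow> (real^'n \<Rightarrow> real) topology" where
  "W_topology \<Omega> s q p = norm_topology (W_space \<Omega> s q p) (W_norm \<Omega> s q p)"

definition W0_space ::
  "(real^'n) set \<Rightarrow> real \<Rightarrow> (real^'n \<Rightarrow> real) \<Rightarrow> ((real^'n) \<times> (real^'n) \<Rightarrow> real)
    \<Rightarrow> (real^'n \<Rightarrow> real) set" where
  "W0_space \<Omega> s q p = W_topology \<Omega> s q p closure_of
     {u \<in> W_space \<Omega> s q p. \<exists>K. compact K \<and> K \<subseteq> \<Omega> \<and>
        (AE x in lebesgue_on \<Omega>. u x = u x * indicator K x)}"

text \<open>The function type is not an instance of \<open>real_vector\<close>, so the linear subspace condition is
  written out.\<close>

definition linear_subspace :: "('a \<Rightarrow> real) set \<Rightarrow> bool" where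
  "linear_subspace I \<longleftrightarrow> (\<lambda>x. 0) \<in> I \<and>
     (\<forall>u\<in>I. \<forall>v\<in>I. (\<lambda>x. u x + v x) \<in> I) \<and>
     (\<forall>c. \<forall>u\<in>I. (\<lambda>x. c * u x) \<in> I)"

definition W_ideal ::
  "(real^'n) set \<Rightarrow> real \<Rightarrow> (real^'n \<Rightarrow> real) \<Rightarrow> ((real^'n) \<times> (real^'n) \<Rightarrow> real)
    \<Rightarrow> (real^'n \<Rightarrow> real) set \<Rightarrow> bool" where
  "W_ideal \<Omega> s q p I \<longleftrightarrow> I \<subseteq> W_space \<Omega> s q p \<and> linear_subspace I \<and>
     (\<forall>u\<in>I. \<forall>v\<in>W_space \<Omega> s q p. (AE x in lebesgue_on \<Omega>. \<bar>v x\<bar> \<le> \<bar>u x\<bar>) \<longrightarrow> v \<in> I)"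

end

theory Submission
  imports Defs
begin

text \<open>Both parts of the norm are Luxemburg norms of modulars \<open>\<integral> \<bar>f\<bar>\<^sup>r\<close> with a bounded exponent \<open>r\<close>, so convergence
  in norm is the same as convergence of the modular, and \<open>W\<^sub>0\<close> consists of the modular limits of
  compactly supported functions; this makes it a closed subspace. For the ideal property let
  \<open>w\<^sub>k \<rightarrow> u\<close> with \<open>w\<^sub>k\<close> compactly supported and modular distances at most \<open>2\<^sup>-\<^sup>k\<close>, and let
  \<open>\<bar>v\<bar> \<le> \<bar>u\<bar>\<close>. Truncating \<open>v\<close> to the interval \<open>[-\<bar>w\<^sub>k\<bar>, \<bar>w\<^sub>k\<bar>]\<close> gives compactly supported \<open>y\<^sub>k\<close> with
  \<open>\<bar>y\<^sub>k - v\<bar> \<le> \<bar>w\<^sub>k - u\<bar>\<close>. Truncation is 1-Lipschitz in both arguments, so the difference quotients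
  of \<open>y\<^sub>k - v\<close> are dominated by those of \<open>v\<close>, \<open>u\<close> and \<open>w\<^sub>k - u\<close>. Summability of the modular distances
  yields both almost everywhere convergence and an integrable majorant for all \<open>k\<close>, and dominated
  convergence finishes the proof.\<close>

section \<open>Modulars and Luxemburg norms\<close>

text \<open>The measure is kept abstract so that one theory serves both the \<open>q\<close>-part on
  \<Omega> and, after rewriting difference quotients, the Gagliardo part on \<Omega> \<times>
  \<Omega>.\<close>

definition vmod :: "'a measure \<Rightarrow> ('a \<Rightarrow> real) \<Rightarrow> ('a \<Rightarrow> real) \<Rightarrow> ennreal" where
  "vmod M r f = (\<integral>\<^sup>+x. ennreal (\<bar>f x\<bar> powr r x) \<partial>M)"

definition lux :: "'a measure \<Rightarrow> ('a \<Rightarrow> real) \<Rightarrow> ('a \<Rightarrow> real) \<Rightarrow> real" where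
  "lux M r f = Inf {t. 0 < t \<and> vmod M r (\<lambda>x. f x / t) \<le> 1}"

text \<open>For positive arguments this is convexity of the power function. If one argument
  vanishes, it reduces to \<open>c powr p \<le> c\<close> for \<open>0 < c < 1\<close>.\<close>

lemma powr_convex_comb:
  fixes a b t p :: real
  assumes "1 \<le> p" "0 \<le> a" "0 \<le> b" "0 < t" "t < 1"
  shows "((1 - t) * a + t * b) powr p \<le> (1 - t) * a powr p + t * b powr p"
proof -
  have shrink: "(c * x) powr p \<le> c * x powr p" if "0 < c" "c < 1" "0 \<le> x" for c x :: real
  proof -
    have "c powr p \<le> c powr 1" using that assms by (intro powr_mono') auto
    then show ?thesis using that by (simp add: powr_mult mult_right_mono)
  qed
  consider "a = 0" | "b = 0" | "0 < a" "0 < b" using assms by linarith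
  then show ?thesis
  proof cases
    case 1 then show ?thesis using shrink[of t b] assms by simp
  next
    case 2 then show ?thesis using shrink[of "1 - t" a] assms by simp
  next
    case 3 then show ?thesis
      using convex_onD[OF powr_convex[OF \<open>1 \<le> p\<close>], of t a b] assms by simp
  qed
qed

text \<open>The sum is at most \<open>2 * max a b\<close>. The constant depends only on the upper
  bound \<open>P\<close>, so it can be pulled out of an integral when \<open>p\<close> varies with
  the point.\<close>

lemma powr_add_le:
  fixes a b p P :: real
  assumes "1 \<le> p" "p \<le> P" "0 \<le> a" "0 \<le> b"
  shows "(a + b) powr p \<le> 2 powr P * (a powr p + b powr p)"
proof -
  have "(a + b) powr p \<le> (2 * max a b) powr p"
    using assms by (intro powr_mono2) auto
  also have "\<dots> = 2 powr p * max a b powr p" using assms by (simp add: powr_mult)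
  also have "\<dots> \<le> 2 powr P * (a powr p + b powr p)"
    using assms by (intro mult_mono powr_mono) (auto simp: max_def)
  finally show ?thesis .
qed

text \<open>The lower bound holds everywhere and the upper one almost everywhere, matching what
  \<open>exponents\<close> and a finite \<open>esssup\<close> supply.\<close>

locale bounded_exponent =
  fixes M :: "'a measure" and r :: "'a \<Rightarrow> real" and P :: real
  assumes r_measurable [measurable]: "r \<in> borel_measurable M"
    and r_ge_1: "x \<in> space M \<Longrightarrow> 1 \<le> r x"
    and r_le_AE: "AE x in M. r x \<le> P"
begin

lemma vmod_mono:
  assumes "AE x in M. \<bar>f x\<bar> \<le> \<bar>g x\<bar>"
  shows "vmod M r f \<le> vmod M r g"
  unfolding vmod_def
  using assms AE_space[of M]
  by (intro nn_integral_mono_AE, eventually_elim)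
    (use r_ge_1 in \<open>force intro!: ennreal_leI powr_mono2\<close>)

text \<open>A factor of absolute value at most 1 contributes at most 1, a larger one at most its
  \<open>P\<close>-th power. This uniform bound is where boundedness of the exponent enters the
  passage from small modular to small norm.\<close>

lemma vmod_cmult_le:
  assumes [measurable]: "f \<in> borel_measurable M"
  shows "vmod M r (\<lambda>x. c * f x) \<le> ennreal (max 1 (\<bar>c\<bar> powr P)) * vmod M r f"
proof -
  have "vmod M r (\<lambda>x. c * f x) \<le> (\<integral>\<^sup>+x. ennreal (max 1 (\<bar>c\<bar> powr P)) * ennreal (\<bar>f x\<bar> powr r x) \<partial>M)"
    unfolding vmod_def
    using r_le_AE AE_space[of M]
  proof (intro nn_integral_mono_AE, eventually_elim)
    case (elim x)
    then have r: "1 \<le> r x" "r x \<le> P" using r_ge_1 by auto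
    have "\<bar>c\<bar> powr r x \<le> max 1 (\<bar>c\<bar> powr P)"
    proof (cases "\<bar>c\<bar> \<le> 1")
      case True
      then have "\<bar>c\<bar> powr r x \<le> 1 powr r x"
        using r by (intro powr_mono2) auto
      then show ?thesis by simp
    next
      case False
      then have "\<bar>c\<bar> powr r x \<le> \<bar>c\<bar> powr P" using r by (intro powr_mono) auto
      then show ?thesis by simp
    qed
    then show ?case
      by (simp add: abs_mult powr_mult mult_right_mono flip: ennreal_mult)
  qed
  also have "\<dots> = ennreal (max 1 (\<bar>c\<bar> powr P)) * vmod M r f"
    unfolding vmod_def by (rule nn_integral_cmult) measurable
  finally show ?thesis .
qed

text \<open>For \<open>t \<le> 1\<close> and exponents at least 1 one has
  \<open>t powr r x \<le> t\<close>. Unlike the general scaling bound, this gains a small factor, as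
  needed to pass from norm to modular.\<close>

lemma vmod_shrink:
  assumes [measurable]: "f \<in> borel_measurable M" and t: "0 < t" "t \<le> 1"
  shows "vmod M r (\<lambda>x. t * f x) \<le> ennreal t * vmod M r f"
proof -
  have "vmod M r (\<lambda>x. t * f x) \<le> (\<integral>\<^sup>+x. ennreal t * ennreal (\<bar>f x\<bar> powr r x) \<partial>M)"
    unfolding vmod_def
  proof (intro nn_integral_mono)
    fix x assume "x \<in> space M"
    then have "t powr r x \<le> t powr 1" using r_ge_1 t by (intro powr_mono') auto
    then show "ennreal (\<bar>t * f x\<bar> powr r x) \<le> ennreal t * ennreal (\<bar>f x\<bar> powr r x)"
      using t by (simp add: abs_mult powr_mult ennreal_mult[symmetric] mult_right_mono)
  qed
  also have "\<dots> = ennreal t * vmod M r f"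
    unfolding vmod_def by (rule nn_integral_cmult) measurable
  finally show ?thesis .
qed

lemma vmod_add_le:
  assumes [measurable]: "f \<in> borel_measurable M" "g \<in> borel_measurable M"
  shows "vmod M r (\<lambda>x. f x + g x) \<le> ennreal (2 powr P) * (vmod M r f + vmod M r g)"
proof -
  have "vmod M r (\<lambda>x. f x + g x)
      \<le> (\<integral>\<^sup>+x. ennreal (2 powr P) * (ennreal (\<bar>f x\<bar> powr r x) + ennreal (\<bar>g x\<bar> powr r x)) \<partial>M)"
    unfolding vmod_def
    using r_le_AE AE_space[of M]
  proof (intro nn_integral_mono_AE, eventually_elim)
    case (elim x)
    then have r: "1 \<le> r x" "r x \<le> P" using r_ge_1 by auto
    have "\<bar>f x + g x\<bar> powr r x \<le> (\<bar>f x\<bar> + \<bar>g x\<bar>) powr r x"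
      using r by (intro powr_mono2) auto
    also have "\<dots> \<le> 2 powr P * (\<bar>f x\<bar> powr r x + \<bar>g x\<bar> powr r x)"
      using r by (intro powr_add_le) auto
    finally show ?case
      by (simp flip: ennreal_plus ennreal_mult)
  qed
  also have "\<dots> = ennreal (2 powr P) * (vmod M r f + vmod M r g)"
    unfolding vmod_def by (subst nn_integral_cmult) (auto simp: nn_integral_add)
  finally show ?thesis .
qed

text \<open>The scaled sum is a convex combination of \<open>f / s\<close> and \<open>g / t\<close>
  with weights \<open>s / (s + t)\<close> and \<open>t / (s + t)\<close>, so convexity of the
  modular applies. This is the triangle inequality of the Luxemburg norm before taking
  infima.\<close>

lemma vmod_convex:
  assumes [measurable]: "f \<in> borel_measurable M" "g \<in> borel_measurable M"
    and st: "0 < s" "0 < t"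
    and le: "vmod M r (\<lambda>x. f x / s) \<le> 1" "vmod M r (\<lambda>x. g x / t) \<le> 1"
  shows "vmod M r (\<lambda>x. (f x + g x) / (s + t)) \<le> 1"
proof -
  define l where "l = t / (s + t)"
  have l: "0 < l" "l < 1" using st by (auto simp: l_def)
  have ls: "1 - l = s / (s + t)" using st by (simp add: l_def field_simps)
  have "vmod M r (\<lambda>x. (f x + g x) / (s + t))
      \<le> (\<integral>\<^sup>+x. ennreal (1 - l) * ennreal (\<bar>f x / s\<bar> powr r x) + ennreal l * ennreal (\<bar>g x / t\<bar> powr r x) \<partial>M)"
    unfolding vmod_def
  proof (intro nn_integral_mono)
    fix x assume "x \<in> space M"
    then have r: "1 \<le> r x" by (rule r_ge_1)
    have "\<bar>(f x + g x) / (s + t)\<bar> \<le> (1 - l) * \<bar>f x / s\<bar> + l * \<bar>g x / t\<bar>"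
      using st by (simp add: ls) (simp add: l_def divide_simps abs_mult)
    then have "\<bar>(f x + g x) / (s + t)\<bar> powr r x \<le> ((1 - l) * \<bar>f x / s\<bar> + l * \<bar>g x / t\<bar>) powr r x"
      using r by (intro powr_mono2) auto
    also have "\<dots> \<le> (1 - l) * \<bar>f x / s\<bar> powr r x + l * \<bar>g x / t\<bar> powr r x"
      using r l by (intro powr_convex_comb) auto
    finally show "ennreal (\<bar>(f x + g x) / (s + t)\<bar> powr r x)
        \<le> ennreal (1 - l) * ennreal (\<bar>f x / s\<bar> powr r x) + ennreal l * ennreal (\<bar>g x / t\<bar> powr r x)"
      using l by (simp flip: ennreal_plus ennreal_mult)
  qed
  also have "\<dots> = ennreal (1 - l) * vmod M r (\<lambda>x. f x / s) + ennreal l * vmod M r (\<lambda>x. g x / t)"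
    unfolding vmod_def by (subst nn_integral_add) (auto simp: nn_integral_cmult)
  also have "\<dots> \<le> ennreal (1 - l) * 1 + ennreal l * 1"
    using le by (intro add_mono mult_left_mono) auto
  also have "\<dots> = 1" using l by (simp flip: ennreal_plus)
  finally show ?thesis .
qed

section \<open>The Luxemburg norm and its comparison with the modular\<close>

lemma lux_nonempty:
  assumes [measurable]: "f \<in> borel_measurable M" and fin: "vmod M r f < \<infinity>"
  shows "\<exists>t>0. vmod M r (\<lambda>x. f x / t) \<le> 1"
proof -
  obtain c where c: "0 \<le> c" "vmod M r f = ennreal c"
    using fin by (cases "vmod M r f") auto
  \<comment> \<open>Shrinking by this factor brings the modular down to at most
    \<open>c / (1 + c) \<le> 1\<close>. Adding 1 to \<open>c\<close> keeps the denominator positive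
    when the modular is zero.\<close>
  define t where "t = 1 / (1 + c)"
  have t: "0 < t" "t \<le> 1" using c by (auto simp: t_def)
  have "vmod M r (\<lambda>x. t * f x) \<le> ennreal t * ennreal c"
    using vmod_shrink[OF assms(1) t] c by simp
  also have "\<dots> = ennreal (t * c)" using c t by (simp add: ennreal_mult)
  also have "\<dots> \<le> 1" using c by (simp add: t_def field_simps)
  finally show ?thesis
    using c by (intro exI[of _ "1 + c"]) (simp add: t_def)
qed

lemma lux_le: "0 < t \<Longrightarrow> vmod M r (\<lambda>x. f x / t) \<le> 1 \<Longrightarrow> lux M r f \<le> t"
  unfolding lux_def by (rule cInf_lower) (auto intro!: bdd_belowI[of _ 0])

lemma lux_lessD:
  assumes "f \<in> borel_measurable M" "vmod M r f < \<infinity>" "lux M r f < e"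
  obtains t where "0 < t" "t < e" "vmod M r (\<lambda>x. f x / t) \<le> 1"
  using cInf_lessD[of "{t. 0 < t \<and> vmod M r (\<lambda>x. f x / t) \<le> 1}" e] lux_nonempty[OF assms(1,2)] assms(3)
  unfolding lux_def by blast

lemma lux_nonneg:
  assumes "f \<in> borel_measurable M" "vmod M r f < \<infinity>"
  shows "0 \<le> lux M r f"
  unfolding lux_def using lux_nonempty[OF assms] by (intro cInf_greatest) auto

lemma lux_triangle:
  assumes f: "f \<in> borel_measurable M" "vmod M r f < \<infinity>"
    and g: "g \<in> borel_measurable M" "vmod M r g < \<infinity>"
  shows "lux M r (\<lambda>x. f x + g x) \<le> lux M r f + lux M r g"
proof (rule field_le_epsilon)
  fix e :: real assume "0 < e"
  then have less: "lux M r f < lux M r f + e/2" "lux M r g < lux M r g + e/2" by auto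
  obtain s where s: "0 < s" "s < lux M r f + e/2" "vmod M r (\<lambda>x. f x / s) \<le> 1"
    by (rule lux_lessD[OF f less(1)])
  obtain t where t: "0 < t" "t < lux M r g + e/2" "vmod M r (\<lambda>x. g x / t) \<le> 1"
    by (rule lux_lessD[OF g less(2)])
  have "lux M r (\<lambda>x. f x + g x) \<le> s + t"
    using s t f g by (intro lux_le vmod_convex) auto
  then show "lux M r (\<lambda>x. f x + g x) \<le> lux M r f + lux M r g + e" using s t by linarith
qed

text \<open>Some admissible \<open>t\<close> lies below \<open>e \<le> 1\<close>. Writing
  \<open>f\<close> as \<open>t\<close> times \<open>f / t\<close>, the shrinking bound gives a
  modular of at most \<open>t\<close>.\<close>

lemma vmod_le_of_lux_less:
  assumes f: "f \<in> borel_measurable M" "vmod M r f < \<infinity>"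
    and "lux M r f < e" "e \<le> 1"
  shows "vmod M r f \<le> ennreal e"
proof -
  obtain t where t: "0 < t" "t < e" "vmod M r (\<lambda>x. f x / t) \<le> 1"
    using lux_lessD[OF f assms(3)] .
  have "vmod M r (\<lambda>x. t * (f x / t)) \<le> ennreal t * vmod M r (\<lambda>x. f x / t)"
    using f t assms by (intro vmod_shrink) auto
  also have "\<dots> \<le> ennreal t * 1" using t by (intro mult_left_mono) auto
  also have "\<dots> \<le> ennreal e" using t by (simp add: ennreal_leI)
  finally show ?thesis using t by simp
qed

lemma lux_less_of_vmod_le:
  assumes e: "0 < e"
  obtains d where "0 < d"
    "\<And>f. f \<in> borel_measurable M \<Longrightarrow> vmod M r f \<le> ennreal d \<Longrightarrow> lux M r f < e"
proof
  \<comment> \<open>\<open>C\<close> bounds the growth of the modular under scaling by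
    \<open>2 / e\<close>. A modular of at most \<open>1 / C\<close> thus makes \<open>e / 2\<close>
    admissible in the infimum; the factor 2 yields the strict inequality.\<close>
  define C where "C = max 1 (\<bar>2 / e\<bar> powr P)"
  have C: "1 \<le> C" by (simp add: C_def)
  show "0 < 1 / C" using C by simp
  fix f assume f: "f \<in> borel_measurable M" "vmod M r f \<le> ennreal (1 / C)"
  have "vmod M r (\<lambda>x. (2 / e) * f x) \<le> ennreal C * vmod M r f"
    unfolding C_def by (rule vmod_cmult_le[OF f(1)])
  also have "\<dots> \<le> ennreal C * ennreal (1 / C)" by (intro mult_left_mono f) simp
  also have "\<dots> = 1" using C by (simp flip: ennreal_mult)
  finally have "lux M r f \<le> e / 2" using e by (intro lux_le) (auto simp: field_simps)
  then show "lux M r f < e" using e by simp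
qed

end

section \<open>Convergence along sequences with summable modulars\<close>

lemma ennreal_le_suminf: "F k \<le> (\<Sum>k. F k)" for F :: "nat \<Rightarrow> ennreal"
proof -
  have "sum F {k} \<le> suminf F" by (rule sum_le_suminf[OF summableI]) auto
  then show ?thesis by simp
qed

context bounded_exponent
begin

text \<open>Exchanging sum and integral shows that the series of powers is finite almost everywhere,
  so its terms vanish in the limit. No passage to a subsequence is involved.\<close>

lemma vmod_summable_AE_tendsto:
  assumes f [measurable]: "\<And>k. f k \<in> borel_measurable M"
    and fin: "(\<Sum>k. vmod M r (f k)) < \<infinity>"
  shows "AE x in M. (\<lambda>k. f k x) \<longlonglongrightarrow> 0"
proof -
  have "(\<integral>\<^sup>+x. (\<Sum>k. ennreal (\<bar>f k x\<bar> powr r x)) \<partial>M) = (\<Sum>k. vmod M r (f k))"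
    unfolding vmod_def by (rule nn_integral_suminf) measurable
  then have "AE x in M. (\<Sum>k. ennreal (\<bar>f k x\<bar> powr r x)) \<noteq> \<infinity>"
    using fin by (intro nn_integral_PInf_AE) auto
  then show ?thesis using AE_space
  proof eventually_elim
    case (elim x)
    then have "summable (\<lambda>k. \<bar>f k x\<bar> powr r x)"
      by (intro summable_suminf_not_top) auto
    then have "(\<lambda>k. \<bar>f k x\<bar> powr r x) \<longlonglongrightarrow> 0" by (rule summable_LIMSEQ_zero)
    \<comment> \<open>At a fixed point the exponent is a constant at least 1, so taking the
      \<open>r x\<close>-th root preserves convergence to 0.\<close>
    then have "(\<lambda>k. (\<bar>f k x\<bar> powr r x) powr (1 / r x)) \<longlonglongrightarrow> 0"
      by (rule tendsto_zero_powrI[OF _ tendsto_const]) (use r_ge_1[OF elim(2)] in auto)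
    moreover have "(\<bar>f k x\<bar> powr r x) powr (1 / r x) = \<bar>f k x\<bar>" for k
      using r_ge_1[OF elim(2)] by (simp add: powr_powr)
    ultimately show ?case by (simp add: tendsto_rabs_zero_iff)
  qed
qed

text \<open>The dominating function may vary with \<open>k\<close> through \<open>h k\<close>,
  because summability of the modulars allows all of these terms to be absorbed into a single
  integrable majorant.\<close>

lemma vmod_dominated_convergence:
  assumes f [measurable]: "\<And>k. f k \<in> borel_measurable M"
    and h [measurable]: "\<And>k. h k \<in> borel_measurable M"
    and g [measurable]: "g \<in> borel_measurable M"
    and le: "\<And>k. AE x in M. \<bar>f k x\<bar> \<le> \<bar>g x\<bar> + \<bar>h k x\<bar>"
    and gfin: "vmod M r g < \<infinity>" and hfin: "(\<Sum>k. vmod M r (h k)) < \<infinity>"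
    and lim: "AE x in M. (\<lambda>k. f k x) \<longlonglongrightarrow> 0"
  shows "(\<lambda>k. vmod M r (f k)) \<longlonglongrightarrow> 0"
proof -
  \<comment> \<open>The majorant contains the whole series of powers of the \<open>h k\<close>; each
    individual term is bounded by that series, hence \<open>w\<close> works for every
    \<open>k\<close>.\<close>
  define w where "w x = ennreal (2 powr P) *
    (ennreal (\<bar>g x\<bar> powr r x) + (\<Sum>k. ennreal (\<bar>h k x\<bar> powr r x)))" for x
  have wM [measurable]: "w \<in> borel_measurable M" unfolding w_def by measurable
  have "(\<integral>\<^sup>+x. w x \<partial>M) = ennreal (2 powr P) *
      ((\<integral>\<^sup>+x. ennreal (\<bar>g x\<bar> powr r x) \<partial>M) + (\<integral>\<^sup>+x. (\<Sum>k. ennreal (\<bar>h k x\<bar> powr r x)) \<partial>M))"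
    unfolding w_def by (subst nn_integral_cmult) (auto simp: nn_integral_add)
  also have "(\<integral>\<^sup>+x. (\<Sum>k. ennreal (\<bar>h k x\<bar> powr r x)) \<partial>M) = (\<Sum>k. vmod M r (h k))"
    unfolding vmod_def by (rule nn_integral_suminf) measurable
  finally have wfin: "(\<integral>\<^sup>+x. w x \<partial>M) < \<infinity>"
    using gfin hfin by (simp add: vmod_def ennreal_mult_less_top)
  have "(\<lambda>k. \<integral>\<^sup>+x. ennreal (\<bar>f k x\<bar> powr r x) \<partial>M) \<longlonglongrightarrow> (\<integral>\<^sup>+x. 0 \<partial>M)"
  proof (rule nn_integral_dominated_convergence[OF _ _ wM _ wfin])
    fix k
    show "AE x in M. ennreal (\<bar>f k x\<bar> powr r x) \<le> w x"
      using le[of k] r_le_AE AE_space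
    proof eventually_elim
      case (elim x)
      then have r: "1 \<le> r x" "r x \<le> P" using r_ge_1 by auto
      have "\<bar>f k x\<bar> powr r x \<le> (\<bar>g x\<bar> + \<bar>h k x\<bar>) powr r x"
        using r elim by (intro powr_mono2) auto
      also have "\<dots> \<le> 2 powr P * (\<bar>g x\<bar> powr r x + \<bar>h k x\<bar> powr r x)"
        using r by (intro powr_add_le) auto
      finally have "ennreal (\<bar>f k x\<bar> powr r x)
          \<le> ennreal (2 powr P) * (ennreal (\<bar>g x\<bar> powr r x) + ennreal (\<bar>h k x\<bar> powr r x))"
        by (simp flip: ennreal_plus ennreal_mult)
      also have "\<dots> \<le> w x"
        unfolding w_def by (intro mult_left_mono add_left_mono ennreal_le_suminf) simp
      finally show ?case .
    qed
  next
    show "AE x in M. (\<lambda>k. ennreal (\<bar>f k x\<bar> powr r x)) \<longlonglongrightarrow> 0"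
      using lim AE_space
    proof eventually_elim
      case (elim x)
      have "(\<lambda>k. \<bar>f k x\<bar> powr r x) \<longlonglongrightarrow> 0"
        by (rule tendsto_zero_powrI[OF tendsto_rabs_zero[OF elim(1)] tendsto_const])
          (use r_ge_1[OF elim(2)] in auto)
      then have "(\<lambda>k. ennreal (\<bar>f k x\<bar> powr r x)) \<longlonglongrightarrow> ennreal 0" by (rule tendsto_ennrealI)
      then show ?case by simp
    qed
  qed auto
  then show ?thesis by (simp add: vmod_def)
qed

end

section \<open>Null sets and measurability on products\<close>

text \<open>These preimages are cylinders over \<open>N\<close>, whose product measure is zero times
  infinity, that is 0.\<close>

lemma null_sets_lborel_fst_snd:
  fixes N :: "'a::euclidean_space set"
  assumes "N \<in> null_sets lborel"
  shows "(fst -` N :: ('a \<times> 'b::euclidean_space) set) \<in> null_sets lborel"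
    and "(snd -` N :: ('b \<times> 'a) set) \<in> null_sets lborel"
proof -
  have N: "N \<in> sets lborel" "emeasure lborel N = 0" using assms by auto
  have eq: "(fst -` N :: ('a \<times> 'b) set) = N \<times> UNIV" "(snd -` N :: ('b \<times> 'a) set) = UNIV \<times> N"
    by auto
  have "N \<times> (UNIV::'b set) \<in> null_sets (lborel \<Otimes>\<^sub>M lborel)"
    using N by (intro null_setsI) (auto simp: lborel.emeasure_pair_measure_Times)
  then show "(fst -` N :: ('a \<times> 'b) set) \<in> null_sets lborel" by (simp add: eq lborel_prod)
  have "(UNIV::'b set) \<times> N \<in> null_sets (lborel \<Otimes>\<^sub>M lborel)"
    using N by (intro null_setsI) (auto simp: lborel.emeasure_pair_measure_Times)
  then show "(snd -` N :: ('b \<times> 'a) set) \<in> null_sets lborel" by (simp add: eq lborel_prod)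
qed

text \<open>Continuity gives measurability into the Borel sets; the extension to the completed
  target uses that preimages of null sets are null. It is needed to compose the projections with
  functions that are only Lebesgue measurable.\<close>

lemma measurable_fst_snd_lebesgue:
  shows "(fst :: 'a::euclidean_space \<times> 'b::euclidean_space \<Rightarrow> 'a) \<in> lebesgue \<rightarrow>\<^sub>M lebesgue"
    and "(snd :: 'b \<times> 'a \<Rightarrow> 'a) \<in> lebesgue \<rightarrow>\<^sub>M lebesgue"
proof -
  have fst: "(fst :: 'a \<times> 'b \<Rightarrow> 'a) \<in> lebesgue \<rightarrow>\<^sub>M lborel"
    and snd: "(snd :: 'b \<times> 'a \<Rightarrow> 'a) \<in> lebesgue \<rightarrow>\<^sub>M lborel"
    by (auto intro!: measurable_completion borel_measurable_continuous_onI continuous_intros)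
  show "(fst :: 'a \<times> 'b \<Rightarrow> 'a) \<in> lebesgue \<rightarrow>\<^sub>M lebesgue"
  proof (rule completion.measurable_completion2[OF fst], rule subsetI)
    fix N :: "'a set" assume N: "N \<in> null_sets lborel"
    show "N \<in> null_sets (distr lebesgue lborel (fst :: 'a \<times> 'b \<Rightarrow> 'a))"
      using null_setsD2[OF N] null_sets_completionI[OF null_sets_lborel_fst_snd(1)[OF N]]
      by (simp add: null_sets_distr_iff[OF fst])
  qed
  show "(snd :: 'b \<times> 'a \<Rightarrow> 'a) \<in> lebesgue \<rightarrow>\<^sub>M lebesgue"
  proof (rule completion.measurable_completion2[OF snd], rule subsetI)
    fix N :: "'a set" assume N: "N \<in> null_sets lborel"
    show "N \<in> null_sets (distr lebesgue lborel (snd :: 'b \<times> 'a \<Rightarrow> 'a))"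
      using null_setsD2[OF N] null_sets_completionI[OF null_sets_lborel_fst_snd(2)[OF N]]
      by (simp add: null_sets_distr_iff[OF snd])
  qed
qed

lemma measurable_lebesgue_on_Times:
  fixes S :: "'a::euclidean_space set" and T :: "'b::euclidean_space set"
  shows "fst \<in> lebesgue_on (S \<times> T) \<rightarrow>\<^sub>M lebesgue_on S"
    and "snd \<in> lebesgue_on (S \<times> T) \<rightarrow>\<^sub>M lebesgue_on T"
  by (auto intro!: measurable_restrict_space3 measurable_fst_snd_lebesgue)

lemma AE_lebesgue_fst_snd:
  fixes Q :: "'a::euclidean_space \<Rightarrow> bool"
  assumes "AE x in lebesgue. Q x"
  shows "AE z::'a \<times> 'a in lebesgue. Q (fst z) \<and> Q (snd z)"
proof -
  have "AE x in lborel. Q x" using assms by (simp add: AE_completion_iff)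
  then obtain N where N: "N \<in> null_sets lborel" "{x. \<not> Q x} \<subseteq> N"
    by (auto simp: eventually_ae_filter)
  have "AE z::'a \<times> 'a in lborel. fst z \<notin> N"
    using AE_not_in[OF null_sets_lborel_fst_snd(1)[OF N(1)]] by simp
  moreover have "AE z::'a \<times> 'a in lborel. snd z \<notin> N"
    using AE_not_in[OF null_sets_lborel_fst_snd(2)[OF N(1)]] by simp
  ultimately have "AE z::'a \<times> 'a in lborel. Q (fst z) \<and> Q (snd z)"
    by eventually_elim (use N in auto)
  then show ?thesis by (rule AE_completion)
qed

lemma AE_lebesgue_on_fst_snd:
  fixes S :: "'a::euclidean_space set"
  assumes S: "open S" and "AE x in lebesgue_on S. Q x"
  shows "AE z in lebesgue_on (S \<times> S). Q (fst z) \<and> Q (snd z)"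
proof -
  have SS: "S \<in> sets lebesgue" "S \<times> S \<in> sets lebesgue"
    using S by (auto intro!: sets_completionI_sets simp: open_Times)
  have "AE x in lebesgue. x \<in> S \<longrightarrow> Q x" using assms SS by (simp add: AE_restrict_space_iff)
  from AE_lebesgue_fst_snd[OF this] show ?thesis
    using SS by (auto simp: AE_restrict_space_iff elim: eventually_mono)
qed

section \<open>The fractional Sobolev space\<close>

text \<open>The exponent is divided by \<open>p z\<close> so that the Gagliardo integral becomes the modular of a function
  depending linearly on \<open>u\<close>, with no weight left over.\<close>

definition hquot :: "real \<Rightarrow> ((real^'n) \<times> (real^'n) \<Rightarrow> real) \<Rightarrow> (real^'n \<Rightarrow> real)
    \<Rightarrow> (real^'n) \<times> (real^'n) \<Rightarrow> real" where
  "hquot s p u z = (u (fst z) - u (snd z)) *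
     norm (fst z - snd z) powr (- (real CARD('n) + s * p z) / p z)"

lemma hquot_add: "hquot s p (\<lambda>x. u x + v x) = (\<lambda>z. hquot s p u z + hquot s p v z)"
  by (simp add: hquot_def fun_eq_iff algebra_simps)

lemma hquot_cmult: "hquot s p (\<lambda>x. c * u x) = (\<lambda>z. c * hquot s p u z)"
  by (simp add: hquot_def fun_eq_iff algebra_simps)

lemma hquot_diff: "hquot s p (\<lambda>x. u x - v x) = (\<lambda>z. hquot s p u z - hquot s p v z)"
  by (simp add: hquot_def fun_eq_iff algebra_simps)

lemma hquot_abs_le:
  assumes "\<bar>u (fst z) - u (snd z)\<bar> \<le> \<bar>v (fst z) - v (snd z)\<bar> + \<bar>w (fst z) - w (snd z)\<bar>"
  shows "\<bar>hquot s p u z\<bar> \<le> \<bar>hquot s p v z\<bar> + \<bar>hquot s p w z\<bar>"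
  using mult_right_mono[OF assms, of "norm (fst z - snd z) powr (- (real CARD('n) + s * p z) / p z)"]
  by (simp add: hquot_def abs_mult distrib_right)

text \<open>Raising the kernel to the power \<open>p z\<close> cancels the division by
  \<open>p z\<close> in its exponent. The conventions \<open>0 powr a = 0\<close> and
  \<open>1 / 0 = 0\<close> make the identity valid on the diagonal too.\<close>

lemma gagliardo_eq_vmod:
  fixes \<Omega> :: "(real^'n) set"
  assumes p: "\<And>z. z \<in> \<Omega> \<times> \<Omega> \<Longrightarrow> 1 \<le> p z" and t: "0 < t"
  shows "gagliardo \<Omega> s p t u = vmod (lebesgue_on (\<Omega> \<times> \<Omega>)) p (\<lambda>z. hquot s p u z / t)"
  unfolding gagliardo_def vmod_def
proof (intro nn_integral_cong)
  fix z assume "z \<in> space (lebesgue_on (\<Omega> \<times> \<Omega>))"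
  then have z: "1 \<le> p z" by (intro p) (simp add: space_restrict_space)
  obtain x y where [simp]: "z = (x, y)" by (cases z)
  have "\<bar>hquot s p u z / t\<bar> powr p z
      = \<bar>u x - u y\<bar> powr p z * (norm (x - y) powr (- (real CARD('n) + s * p z) / p z)) powr p z / t powr p z"
    using t by (simp add: hquot_def abs_mult powr_mult powr_divide)
  also have "(norm (x - y) powr (- (real CARD('n) + s * p z) / p z)) powr p z
      = norm (x - y) powr (- (real CARD('n) + s * p z))"
    using z by (simp only: powr_powr) simp
  also have "\<dots> = 1 / norm (x - y) powr (real CARD('n) + s * p z)"
    by (simp only: powr_minus_divide)
  finally show "(case z of (x, y) \<Rightarrow> ennreal (\<bar>u x - u y\<bar> powr p (x, y) /
        (t powr p (x, y) * norm (x - y) powr (real CARD('n) + s * p (x, y)))))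
      = ennreal (\<bar>hquot s p u z / t\<bar> powr p z)"
    by (simp add: mult.commute)
qed

text \<open>One bound \<open>P\<close> for both exponents gives the two summands of the modular the
  same constants.\<close>

locale variable_sobolev =
  fixes \<Omega> :: "(real^'n) set" and s :: real
    and q :: "real^'n \<Rightarrow> real" and p :: "(real^'n) \<times> (real^'n) \<Rightarrow> real" and P :: real
  assumes open_\<Omega>: "open \<Omega>"
    and q_exp: "bounded_exponent (lebesgue_on \<Omega>) q P"
    and p_exp: "bounded_exponent (lebesgue_on (\<Omega> \<times> \<Omega>)) p P"
begin

sublocale Q: bounded_exponent "lebesgue_on \<Omega>" q P by (rule q_exp)
sublocale R: bounded_exponent "lebesgue_on (\<Omega> \<times> \<Omega>)" p P by (rule p_exp)

abbreviation "qmod \<equiv> vmod (lebesgue_on \<Omega>) q"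
abbreviation "pmod u \<equiv> vmod (lebesgue_on (\<Omega> \<times> \<Omega>)) p (hquot s p u)"
abbreviation "W \<equiv> W_space \<Omega> s q p"
abbreviation "N \<equiv> W_norm \<Omega> s q p"
abbreviation "rho \<equiv> modular \<Omega> s q p"
abbreviation "meas u \<equiv> u \<in> borel_measurable (lebesgue_on \<Omega>)"

lemma gagliardo_eq: "0 < t \<Longrightarrow>
    gagliardo \<Omega> s p t u = vmod (lebesgue_on (\<Omega> \<times> \<Omega>)) p (\<lambda>z. hquot s p u z / t)"
  by (rule gagliardo_eq_vmod) (use R.r_ge_1 in \<open>auto simp: space_restrict_space\<close>)

lemma rho_eq: "rho u = qmod u + pmod u"
  by (simp add: modular_def gagliardo_eq lq_modular_def vmod_def)

lemma N_eq: "N u = lux (lebesgue_on \<Omega>) q u + lux (lebesgue_on (\<Omega> \<times> \<Omega>)) p (hquot s p u)"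
  by (simp add: W_norm_def lq_norm_def gagliardo_seminorm_def lux_def lq_modular_def vmod_def
      gagliardo_eq cong: conj_cong)

lemma W_iff: "u \<in> W \<longleftrightarrow> meas u \<and> qmod u < \<infinity> \<and> pmod u < \<infinity>"
  by (auto simp: W_space_def rho_eq)

lemma hquot_measurable [measurable]:
  assumes "meas u"
  shows "hquot s p u \<in> borel_measurable (lebesgue_on (\<Omega> \<times> \<Omega>))"
proof -
  have [measurable]: "(\<lambda>z. u (fst z)) \<in> borel_measurable (lebesgue_on (\<Omega> \<times> \<Omega>))"
    "(\<lambda>z. u (snd z)) \<in> borel_measurable (lebesgue_on (\<Omega> \<times> \<Omega>))"
    using measurable_compose[OF measurable_lebesgue_on_Times(1) assms]
      measurable_compose[OF measurable_lebesgue_on_Times(2) assms] by auto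
  have [measurable]: "(\<lambda>z. norm (fst z - snd z)) \<in> borel_measurable (lebesgue_on (\<Omega> \<times> \<Omega>))"
    by (intro measurable_restrict_space1 measurable_completion)
      (auto intro!: borel_measurable_continuous_onI continuous_intros)
  show ?thesis unfolding hquot_def by measurable
qed

section \<open>Linear structure, norm and modular of the Sobolev space\<close>

lemma rho_add_le:
  assumes "meas u" "meas v"
  shows "rho (\<lambda>x. u x + v x) \<le> ennreal (2 powr P) * (rho u + rho v)"
proof -
  have "rho (\<lambda>x. u x + v x) \<le> ennreal (2 powr P) * (qmod u + qmod v) + ennreal (2 powr P) * (pmod u + pmod v)"
    unfolding rho_eq hquot_add using assms by (intro add_mono Q.vmod_add_le R.vmod_add_le hquot_measurable)
  then show ?thesis unfolding rho_eq by (simp add: distrib_left add_ac)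
qed

lemma rho_cmult_le:
  assumes "meas u"
  shows "rho (\<lambda>x. c * u x) \<le> ennreal (max 1 (\<bar>c\<bar> powr P)) * rho u"
  unfolding rho_eq hquot_cmult distrib_left
  using assms by (intro add_mono Q.vmod_cmult_le R.vmod_cmult_le hquot_measurable)

lemma rho_zero: "rho (\<lambda>x. 0) = 0"
  by (simp add: rho_eq vmod_def hquot_def)

lemma W_iff_rho: "u \<in> W \<longleftrightarrow> meas u \<and> rho u < \<infinity>"
  by (simp add: W_space_def)

lemma W_zero: "(\<lambda>x. 0) \<in> W"
  by (simp add: W_iff_rho rho_zero)

lemma W_add:
  assumes "u \<in> W" "v \<in> W"
  shows "(\<lambda>x. u x + v x) \<in> W"
proof -
  have "ennreal (2 powr P) * (rho u + rho v) < \<infinity>"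
    using assms by (auto simp: W_iff_rho ennreal_mult_less_top)
  then show ?thesis
    using assms rho_add_le[of u v] by (auto simp: W_iff_rho intro: le_less_trans)
qed

lemma W_cmult:
  assumes "u \<in> W"
  shows "(\<lambda>x. c * u x) \<in> W"
proof -
  have "ennreal (max 1 (\<bar>c\<bar> powr P)) * rho u < \<infinity>"
    using assms by (auto simp: W_iff_rho ennreal_mult_less_top)
  then show ?thesis
    using assms rho_cmult_le[of u c] by (auto simp: W_iff_rho intro: le_less_trans)
qed

lemma W_diff: "u \<in> W \<Longrightarrow> v \<in> W \<Longrightarrow> (\<lambda>x. u x - v x) \<in> W"
  using W_add[OF _ W_cmult[of v "-1"], of u] by simp

lemma N_triangle:
  assumes "u \<in> W" "v \<in> W"
  shows "N (\<lambda>x. u x + v x) \<le> N u + N v"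
proof -
  have "lux (lebesgue_on \<Omega>) q (\<lambda>x. u x + v x) \<le> lux (lebesgue_on \<Omega>) q u + lux (lebesgue_on \<Omega>) q v"
    using assms by (intro Q.lux_triangle) (auto simp: W_iff)
  moreover have "lux (lebesgue_on (\<Omega> \<times> \<Omega>)) p (hquot s p (\<lambda>x. u x + v x))
      \<le> lux (lebesgue_on (\<Omega> \<times> \<Omega>)) p (hquot s p u) + lux (lebesgue_on (\<Omega> \<times> \<Omega>)) p (hquot s p v)"
    unfolding hquot_add using assms by (intro R.lux_triangle) (auto simp: W_iff)
  ultimately show ?thesis by (simp add: N_eq)
qed

lemma rho_le_of_N_less:
  assumes u: "u \<in> W" and e: "N u < e" "e \<le> 1"
  shows "rho u \<le> ennreal (2 * e)"
proof -
  have uW: "meas u" "qmod u < \<infinity>" "hquot s p u \<in> borel_measurable (lebesgue_on (\<Omega> \<times> \<Omega>))" "pmod u < \<infinity>"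
    using u by (auto simp: W_iff)
  \<comment> \<open>Nonnegativity of both seminorms lets each inherit the bound \<open>e\<close>
    from their sum.\<close>
  have nonneg: "0 \<le> lux (lebesgue_on \<Omega>) q u" "0 \<le> lux (lebesgue_on (\<Omega> \<times> \<Omega>)) p (hquot s p u)"
    using uW by (auto intro: Q.lux_nonneg R.lux_nonneg)
  then have "0 \<le> e" using e by (simp add: N_eq)
  have "qmod u \<le> ennreal e" "pmod u \<le> ennreal e"
    using uW e nonneg by (auto intro!: Q.vmod_le_of_lux_less R.vmod_le_of_lux_less simp: N_eq)
  then have "rho u \<le> ennreal e + ennreal e" unfolding rho_eq by (rule add_mono)
  then show ?thesis using \<open>0 \<le> e\<close> by (simp flip: ennreal_plus)
qed

lemma N_less_of_rho_le:
  assumes "0 < e"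
  obtains d where "0 < d" "\<And>u. meas u \<Longrightarrow> rho u \<le> ennreal d \<Longrightarrow> N u < e"
proof -
  have e: "0 < e / 2" using assms by simp
  obtain d1 where d1: "0 < d1"
    "\<And>u. meas u \<Longrightarrow> qmod u \<le> ennreal d1 \<Longrightarrow> lux (lebesgue_on \<Omega>) q u < e / 2"
    using Q.lux_less_of_vmod_le[OF e] by blast
  obtain d2 where d2: "0 < d2"
    "\<And>f. f \<in> borel_measurable (lebesgue_on (\<Omega> \<times> \<Omega>)) \<Longrightarrow> vmod (lebesgue_on (\<Omega> \<times> \<Omega>)) p f \<le> ennreal d2
      \<Longrightarrow> lux (lebesgue_on (\<Omega> \<times> \<Omega>)) p f < e / 2"
    using R.lux_less_of_vmod_le[OF e] by blast
  show ?thesis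
  proof
    show "0 < min d1 d2" using d1 d2 by simp
    fix u assume u: "meas u" "rho u \<le> ennreal (min d1 d2)"
    have "qmod u \<le> rho u" "pmod u \<le> rho u" by (auto simp: rho_eq)
    moreover have "ennreal (min d1 d2) \<le> ennreal d1" "ennreal (min d1 d2) \<le> ennreal d2"
      by (auto intro: ennreal_leI)
    ultimately have "qmod u \<le> ennreal d1" "pmod u \<le> ennreal d2" using u(2) by (meson order_trans)+
    then have "lux (lebesgue_on \<Omega>) q u < e / 2"
      "lux (lebesgue_on (\<Omega> \<times> \<Omega>)) p (hquot s p u) < e / 2"
      using d1(2)[OF u(1)] d2(2)[OF hquot_measurable[OF u(1)]] by auto
    then show "N u < e" by (simp add: N_eq)
  qed
qed

section \<open>Norm and modular descriptions of the closure\<close>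

definition compactly_supported :: "(real^'n \<Rightarrow> real) set" where
  "compactly_supported = {u \<in> W. \<exists>K. compact K \<and> K \<subseteq> \<Omega> \<and>
        (AE x in lebesgue_on \<Omega>. u x = u x * indicator K x)}"

text \<open>Balls form a neighbourhood basis in \<open>norm_topology\<close>: they are open by the
  triangle inequality and contain their centre because \<open>N\<close> is zero-limited at the zero
  function.\<close>

lemma W0_iff_N: "u \<in> W0_space \<Omega> s q p \<longleftrightarrow>
    u \<in> W \<and> (\<forall>e>0. \<exists>w\<in>compactly_supported. N (\<lambda>x. w x - u x) < e)"
proof -
  have W0: "W0_space \<Omega> s q p = norm_topology W N closure_of compactly_supported"
    by (simp add: W0_space_def W_topology_def compactly_supported_def)
  show ?thesis
  proof (intro iffI conjI allI impI)
    assume u: "u \<in> W0_space \<Omega> s q p"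
    then show uW: "u \<in> W" by (simp add: W0 in_closure_of)
    fix e :: real assume e: "0 < e"
    define B where "B = {w \<in> W. N (\<lambda>x. w x - u x) < e}"
    have "openin (norm_topology W N) B"
      unfolding openin_norm_topology
    proof (intro conjI ballI)
      show "B \<subseteq> W" by (auto simp: B_def)
      fix w assume w: "w \<in> B"
      show "\<exists>d>0. \<forall>v\<in>W. N (\<lambda>x. v x - w x) < d \<longrightarrow> v \<in> B"
      proof (intro exI[of _ "e - N (\<lambda>x. w x - u x)"] conjI ballI impI)
        show "0 < e - N (\<lambda>x. w x - u x)" using w by (simp add: B_def)
        fix v assume v: "v \<in> W" "N (\<lambda>x. v x - w x) < e - N (\<lambda>x. w x - u x)"
        have "N (\<lambda>x. (v x - w x) + (w x - u x)) \<le> N (\<lambda>x. v x - w x) + N (\<lambda>x. w x - u x)"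
          using v w uW by (intro N_triangle W_diff) (auto simp: B_def)
        then show "v \<in> B" using v by (simp add: B_def)
      qed
    qed
    moreover have "u \<in> B"
    \<comment> \<open>The value \<open>N (\<lambda>x. 0) < e\<close> follows from the zero function
      having modular 0.\<close>
    proof -
      obtain d where "0 < d" "\<And>u. meas u \<Longrightarrow> rho u \<le> ennreal d \<Longrightarrow> N u < e"
        using N_less_of_rho_le[OF e] by blast
      then show ?thesis using uW by (simp add: B_def rho_zero)
    qed
    ultimately have "\<exists>w. w \<in> compactly_supported \<and> w \<in> B"
      using u by (simp add: W0 in_closure_of)
    then show "\<exists>w\<in>compactly_supported. N (\<lambda>x. w x - u x) < e"
      by (auto simp: B_def)
  next
    assume u: "u \<in> W \<and> (\<forall>e>0. \<exists>w\<in>compactly_supported. N (\<lambda>x. w x - u x) < e)"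
    have "\<exists>w. w \<in> compactly_supported \<and> w \<in> T"
      if T: "u \<in> T" "openin (norm_topology W N) T" for T
    proof -
      obtain e where e: "0 < e" "\<forall>v\<in>W. N (\<lambda>x. v x - u x) < e \<longrightarrow> v \<in> T"
        using T by (auto simp: openin_norm_topology)
      obtain w where "w \<in> compactly_supported" "N (\<lambda>x. w x - u x) < e" using u e by blast
      then show ?thesis using e by (auto simp: compactly_supported_def)
    qed
    then show "u \<in> W0_space \<Omega> s q p" using u by (simp add: W0 in_closure_of)
  qed
qed

text \<open>Small norm and small modular imply each other. All later approximation arguments use
  this form, since limits and scaling are handled directly under the integral.\<close>

lemma W0_iff: "u \<in> W0_space \<Omega> s q p \<longleftrightarrow>
    u \<in> W \<and> (\<forall>e>0. \<exists>w\<in>compactly_supported. rho (\<lambda>x. w x - u x) \<le> ennreal e)"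
  unfolding W0_iff_N
proof (intro conj_cong refl iffI allI impI)
  fix e :: real assume u: "u \<in> W" and e: "0 < e"
    and *: "\<forall>e>0. \<exists>w\<in>compactly_supported. N (\<lambda>x. w x - u x) < e"
  \<comment> \<open>The norm-to-modular estimate requires a radius of at most 1 and loses a factor 2
    for the two summands.\<close>
  define d where "d = min 1 (e / 2)"
  have d: "0 < d" "d \<le> 1" "2 * d \<le> e" using e by (auto simp: d_def)
  obtain w where w: "w \<in> compactly_supported" "N (\<lambda>x. w x - u x) < d" using * d by blast
  have "rho (\<lambda>x. w x - u x) \<le> ennreal (2 * d)"
    using w u d by (intro rho_le_of_N_less W_diff) (auto simp: compactly_supported_def)
  also have "\<dots> \<le> ennreal e" using d by (intro ennreal_leI) simp
  finally show "\<exists>w\<in>compactly_supported. rho (\<lambda>x. w x - u x) \<le> ennreal e" using w by blast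
next
  fix e :: real assume u: "u \<in> W" and e: "0 < e"
    and *: "\<forall>e>0. \<exists>w\<in>compactly_supported. rho (\<lambda>x. w x - u x) \<le> ennreal e"
  obtain d where d: "0 < d" "\<And>u. meas u \<Longrightarrow> rho u \<le> ennreal d \<Longrightarrow> N u < e"
    using N_less_of_rho_le[OF e] by blast
  obtain w where w: "w \<in> compactly_supported" "rho (\<lambda>x. w x - u x) \<le> ennreal d" using * d by blast
  then have "N (\<lambda>x. w x - u x) < e"
    using u by (intro d) (auto simp: compactly_supported_def W_iff)
  then show "\<exists>w\<in>compactly_supported. N (\<lambda>x. w x - u x) < e" using w by blast
qed

end

section \<open>The ideal property\<close>

definition clamp_abs :: "real \<Rightarrow> real \<Rightarrow> real" where
  "clamp_abs a b = max (- \<bar>b\<bar>) (min a \<bar>b\<bar>)"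

lemma clamp_abs_zero [simp]: "clamp_abs a 0 = 0"
  by (auto simp: clamp_abs_def)

text \<open>Either \<open>\<bar>a\<bar> \<le> \<bar>b\<bar>\<close> and nothing changes, or the
  truncation moves \<open>a\<close> by \<open>\<bar>a\<bar> - \<bar>b\<bar> \<le> \<bar>c\<bar> -
  \<bar>b\<bar>\<close>.\<close>

lemma clamp_abs_dist: "\<bar>a\<bar> \<le> \<bar>c\<bar> \<Longrightarrow> \<bar>clamp_abs a b - a\<bar> \<le> \<bar>b - c\<bar>"
  unfolding clamp_abs_def by (smt (verit))

text \<open>Truncation is 1-Lipschitz in each argument separately; changing the arguments one at a
  time gives the sum.\<close>

lemma clamp_abs_lipschitz: "\<bar>clamp_abs a b - clamp_abs a' b'\<bar> \<le> \<bar>a - a'\<bar> + \<bar>b - b'\<bar>"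
  unfolding clamp_abs_def by (smt (verit))

section \<open>Linear subspace property and solidity of the closure\<close>

context variable_sobolev
begin

lemma compactly_supported_zero: "(\<lambda>x. 0) \<in> compactly_supported"
  by (auto simp: compactly_supported_def W_zero intro: exI[of _ "{}"])

lemma compactly_supported_cmult:
  assumes "u \<in> compactly_supported"
  shows "(\<lambda>x. c * u x) \<in> compactly_supported"
proof -
  obtain K where K: "compact K" "K \<subseteq> \<Omega>" "AE x in lebesgue_on \<Omega>. u x = u x * indicator K x"
    using assms by (auto simp: compactly_supported_def)
  have "AE x in lebesgue_on \<Omega>. c * u x = c * u x * indicator K x"
    using K(3) by eventually_elim (simp add: mult.assoc)
  then show ?thesis using K assms by (auto simp: compactly_supported_def W_cmult)
qed

lemma compactly_supported_add:
  assumes "u \<in> compactly_supported" "v \<in> compactly_supported"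
  shows "(\<lambda>x. u x + v x) \<in> compactly_supported"
proof -
  obtain K where K: "compact K" "K \<subseteq> \<Omega>" "AE x in lebesgue_on \<Omega>. u x = u x * indicator K x"
    using assms by (auto simp: compactly_supported_def)
  obtain L where L: "compact L" "L \<subseteq> \<Omega>" "AE x in lebesgue_on \<Omega>. v x = v x * indicator L x"
    using assms by (auto simp: compactly_supported_def)
  have "AE x in lebesgue_on \<Omega>. u x + v x = (u x + v x) * indicator (K \<union> L) x"
    using K(3) L(3) by eventually_elim (auto simp: indicator_def split: if_splits)
  moreover have "compact (K \<union> L)" "K \<union> L \<subseteq> \<Omega>" using K L by auto
  ultimately show ?thesis using assms by (auto simp: compactly_supported_def W_add)
qed

lemma W0_subset: "W0_space \<Omega> s q p \<subseteq> W"
  by (auto simp: W0_iff)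

lemma W0_zero: "(\<lambda>x. 0) \<in> W0_space \<Omega> s q p"
  unfolding W0_iff using W_zero compactly_supported_zero by (auto intro!: bexI simp: rho_zero)

lemma W0_add:
  assumes "u \<in> W0_space \<Omega> s q p" "v \<in> W0_space \<Omega> s q p"
  shows "(\<lambda>x. u x + v x) \<in> W0_space \<Omega> s q p"
  unfolding W0_iff
proof (intro conjI allI impI)
  show "(\<lambda>x. u x + v x) \<in> W" using assms by (intro W_add) (auto simp: W0_iff)
  fix e :: real assume e: "0 < e"
  \<comment> \<open>This compensates for the two error terms and for the constant in the
    quasi-triangle inequality of the modular.\<close>
  define d where "d = e / (2 * 2 powr P)"
  have d: "0 < d" using e by (simp add: d_def)
  obtain w where w: "w \<in> compactly_supported" "rho (\<lambda>x. w x - u x) \<le> ennreal d"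
    using assms d by (auto simp: W0_iff)
  obtain w' where w': "w' \<in> compactly_supported" "rho (\<lambda>x. w' x - v x) \<le> ennreal d"
    using assms d by (auto simp: W0_iff)
  have "rho (\<lambda>x. (w x + w' x) - (u x + v x)) = rho (\<lambda>x. (w x - u x) + (w' x - v x))"
    by (simp add: algebra_simps)
  also have "\<dots> \<le> ennreal (2 powr P) * (rho (\<lambda>x. w x - u x) + rho (\<lambda>x. w' x - v x))"
    using w w' assms by (intro rho_add_le) (auto simp: W0_iff W_iff compactly_supported_def)
  also have "\<dots> \<le> ennreal (2 powr P) * (ennreal d + ennreal d)"
    using w w' by (intro mult_left_mono add_mono) auto
  also have "\<dots> = ennreal e"
    using d by (simp flip: ennreal_plus ennreal_mult) (simp add: d_def)
  finally show "\<exists>w\<in>compactly_supported. rho (\<lambda>x. w x - (u x + v x)) \<le> ennreal e"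
    using compactly_supported_add[OF w(1) w'(1)] by (auto intro!: bexI)
qed

lemma W0_cmult:
  assumes "u \<in> W0_space \<Omega> s q p"
  shows "(\<lambda>x. c * u x) \<in> W0_space \<Omega> s q p"
  unfolding W0_iff
proof (intro conjI allI impI)
  show "(\<lambda>x. c * u x) \<in> W" using assms by (intro W_cmult) (auto simp: W0_iff)
  fix e :: real assume e: "0 < e"
  define C where "C = max 1 (\<bar>c\<bar> powr P)"
  have C: "1 \<le> C" by (simp add: C_def)
  have "0 < e / C" using e C by simp
  obtain w where w: "w \<in> compactly_supported" "rho (\<lambda>x. w x - u x) \<le> ennreal (e / C)"
    using assms \<open>0 < e / C\<close> unfolding W0_iff by blast
  have "rho (\<lambda>x. c * w x - c * u x) = rho (\<lambda>x. c * (w x - u x))"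
    by (simp add: algebra_simps)
  also have "\<dots> \<le> ennreal C * rho (\<lambda>x. w x - u x)"
    unfolding C_def
    using w assms by (intro rho_cmult_le) (auto simp: W0_iff W_iff compactly_supported_def)
  also have "\<dots> \<le> ennreal C * ennreal (e / C)" using w by (intro mult_left_mono) auto
  also have "\<dots> = ennreal e" using e C by (simp flip: ennreal_mult)
  finally show "\<exists>w\<in>compactly_supported. rho (\<lambda>x. w x - c * u x) \<le> ennreal e"
    using compactly_supported_cmult[OF w(1), of c] by (auto intro!: bexI)
qed

text \<open>The \<open>q\<close>-part of \<open>y k - v\<close> is controlled pointwise by
  \<open>w k - u\<close>. Its difference quotients admit no such direct bound, so the Gagliardo part
  goes through dominated convergence instead.\<close>

lemma W0_solid:
  assumes u: "u \<in> W0_space \<Omega> s q p" and v: "v \<in> W"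
    and le: "AE x in lebesgue_on \<Omega>. \<bar>v x\<bar> \<le> \<bar>u x\<bar>"
  shows "v \<in> W0_space \<Omega> s q p"
proof -
  \<comment> \<open>The geometric rate makes the modular distances summable, which supplies both the
    almost everywhere convergence and the majorant below.\<close>
  have "\<forall>k. \<exists>w\<in>compactly_supported. rho (\<lambda>x. w x - u x) \<le> ennreal ((1/2) ^ k)"
    using u by (simp add: W0_iff)
  then obtain w where w: "\<And>k. w k \<in> compactly_supported"
    "\<And>k::nat. rho (\<lambda>x. w k x - u x) \<le> ennreal ((1/2) ^ k)"
    by metis
  define y where "y k x = clamp_abs (v x) (w k x)" for k x
  have meas [measurable]: "meas u" "meas v" "meas (w k)" for k
    using u v w[of k] by (auto simp: W0_iff W_iff compactly_supported_def)
  have [measurable]: "meas (y k)" for k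
    unfolding y_def clamp_abs_def by measurable
  have qp: "qmod (\<lambda>x. w k x - u x) \<le> rho (\<lambda>x. w k x - u x)"
    "pmod (\<lambda>x. w k x - u x) \<le> rho (\<lambda>x. w k x - u x)" for k
    by (auto simp: rho_eq)
  have fin: "(\<Sum>k. ennreal ((1/2) ^ k)) < \<infinity>"
    unfolding infinity_ennreal_def top.not_eq_extremum[symmetric]
    by (rule ennreal_suminf_neq_top[OF summable_geometric]) auto
  have sums: "(\<Sum>k. qmod (\<lambda>x. w k x - u x)) < \<infinity>" "(\<Sum>k. pmod (\<lambda>x. w k x - u x)) < \<infinity>"
    by (rule le_less_trans[OF suminf_le fin], rule order_trans[OF _ w(2)], rule qp, rule summableI, rule summableI)+

  have close: "AE x in lebesgue_on \<Omega>. \<bar>y k x - v x\<bar> \<le> \<bar>w k x - u x\<bar>" for k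
    using le by eventually_elim (simp add: y_def clamp_abs_dist)
  have q_lim: "(\<lambda>k. qmod (\<lambda>x. y k x - v x)) \<longlonglongrightarrow> 0"
  proof (rule tendsto_sandwich[OF _ _ tendsto_const])
    show "\<forall>\<^sub>F k in sequentially. qmod (\<lambda>x. y k x - v x) \<le> ennreal ((1/2) ^ k)"
      using Q.vmod_mono[OF close] qp(1) w(2) by (intro always_eventually allI) (meson order_trans)
    have "(\<lambda>k. ennreal ((1/2) ^ k)) \<longlonglongrightarrow> ennreal 0"
      by (intro tendsto_ennrealI LIMSEQ_realpow_zero) auto
    then show "(\<lambda>k. ennreal ((1/2) ^ k)) \<longlonglongrightarrow> 0" by simp
  qed simp

  have "AE x in lebesgue_on \<Omega>. (\<lambda>k. w k x - u x) \<longlonglongrightarrow> 0"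
    by (rule Q.vmod_summable_AE_tendsto[OF _ sums(1)]) measurable
  moreover have "AE x in lebesgue_on \<Omega>. \<forall>k. \<bar>y k x - v x\<bar> \<le> \<bar>w k x - u x\<bar>"
    using close by (simp add: AE_all_countable)
  ultimately have "AE x in lebesgue_on \<Omega>. (\<lambda>k. y k x - v x) \<longlonglongrightarrow> 0"
  proof eventually_elim
    case (elim x)
    show ?case
      by (rule Lim_null_comparison[OF _ tendsto_rabs_zero[OF elim(1)]]) (use elim(2) in simp)
  qed
  \<comment> \<open>Convergence at almost every point of \<Omega> passes to both coordinates of
    almost every pair; the kernel is independent of \<open>k\<close>.\<close>
  from AE_lebesgue_on_fst_snd[OF open_\<Omega> this]
  have lim: "AE z in lebesgue_on (\<Omega> \<times> \<Omega>). (\<lambda>k. hquot s p (\<lambda>x. y k x - v x) z) \<longlonglongrightarrow> 0"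
  proof eventually_elim
    case (elim z)
    then have "(\<lambda>k. (y k (fst z) - v (fst z)) - (y k (snd z) - v (snd z))) \<longlonglongrightarrow> 0 - 0"
      by (intro tendsto_diff) simp_all
    then show ?case
      unfolding hquot_def by (intro tendsto_mult_left_zero) simp
  qed

  \<comment> \<open>One copy of \<open>v\<close> comes from the Lipschitz bound for
    \<open>y k\<close>, the other from subtracting \<open>v\<close>. The \<open>u\<close> term comes
    from splitting \<open>w k\<close> as \<open>u\<close> plus \<open>w k - u\<close>.\<close>
  define g where "g z = 2 * \<bar>hquot s p v z\<bar> + \<bar>hquot s p u z\<bar>" for z
  note [measurable] = hquot_measurable[OF meas(1)] hquot_measurable[OF meas(2)]
  have abs_finite: "vmod (lebesgue_on (\<Omega> \<times> \<Omega>)) p (\<lambda>z. \<bar>hquot s p f z\<bar>) < \<infinity>" if "f \<in> W" for f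
    using that by (simp add: W_iff vmod_def)
  have g_meas: "g \<in> borel_measurable (lebesgue_on (\<Omega> \<times> \<Omega>))" unfolding g_def by measurable
  have g_fin: "vmod (lebesgue_on (\<Omega> \<times> \<Omega>)) p g < \<infinity>"
  proof -
    have "vmod (lebesgue_on (\<Omega> \<times> \<Omega>)) p (\<lambda>z. 2 * \<bar>hquot s p v z\<bar>)
        \<le> ennreal (max 1 (\<bar>2\<bar> powr P)) * vmod (lebesgue_on (\<Omega> \<times> \<Omega>)) p (\<lambda>z. \<bar>hquot s p v z\<bar>)"
      by (rule R.vmod_cmult_le) measurable
    also have "\<dots> < \<infinity>" using abs_finite[OF v] by (simp add: ennreal_mult_less_top)
    finally have "vmod (lebesgue_on (\<Omega> \<times> \<Omega>)) p (\<lambda>z. 2 * \<bar>hquot s p v z\<bar>) < \<infinity>" .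
    then have "ennreal (2 powr P) * (vmod (lebesgue_on (\<Omega> \<times> \<Omega>)) p (\<lambda>z. 2 * \<bar>hquot s p v z\<bar>)
        + vmod (lebesgue_on (\<Omega> \<times> \<Omega>)) p (\<lambda>z. \<bar>hquot s p u z\<bar>)) < \<infinity>"
      using abs_finite[of u] u by (simp add: ennreal_mult_less_top W0_iff)
    then show ?thesis
      unfolding g_def by (rule le_less_trans[OF R.vmod_add_le, rotated 2]) measurable
  qed
  have dom: "\<bar>hquot s p (\<lambda>x. y k x - v x) z\<bar> \<le> \<bar>g z\<bar> + \<bar>hquot s p (\<lambda>x. w k x - u x) z\<bar>" for k z
  proof -
    have "\<bar>hquot s p (y k) z\<bar> \<le> \<bar>hquot s p v z\<bar> + \<bar>hquot s p (w k) z\<bar>"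
      unfolding y_def by (intro hquot_abs_le clamp_abs_lipschitz)
    then show ?thesis by (simp add: hquot_diff g_def)
  qed
  have p_lim: "(\<lambda>k. pmod (\<lambda>x. y k x - v x)) \<longlonglongrightarrow> 0"
    by (rule R.vmod_dominated_convergence[OF _ _ g_meas _ g_fin sums(2) lim])
      (auto intro!: hquot_measurable dom)

  have rho_lim: "(\<lambda>k. rho (\<lambda>x. y k x - v x)) \<longlonglongrightarrow> 0"
    unfolding rho_eq using tendsto_add[OF q_lim p_lim] by simp
  show ?thesis
    unfolding W0_iff
  proof (intro conjI allI impI)
    fix e :: real assume "0 < e"
    then have "\<forall>\<^sub>F k in sequentially. rho (\<lambda>x. y k x - v x) < ennreal e"
      by (intro order_tendstoD(2)[OF rho_lim]) simp
    then obtain k where k: "rho (\<lambda>x. y k x - v x) < ennreal e"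
      by (auto simp: eventually_sequentially)
    \<comment> \<open>Membership of \<open>y k\<close> in the space is recovered from this
      difference, whose modular is finite by the choice of \<open>k\<close>, by adding
      \<open>v\<close> back.\<close>
    have "(\<lambda>x. y k x - v x) \<in> W" using k by (auto simp: W_iff_rho intro: less_trans)
    from W_add[OF this v] have "y k \<in> W" by simp
    moreover obtain K where K: "compact K" "K \<subseteq> \<Omega>" "AE x in lebesgue_on \<Omega>. w k x = w k x * indicator K x"
      using w(1)[of k] by (auto simp: compactly_supported_def)
    \<comment> \<open>Truncation at level 0 gives 0, so \<open>y k\<close> inherits the compact set
      of \<open>w k\<close>.\<close>
    have "AE x in lebesgue_on \<Omega>. y k x = y k x * indicator K x"
      using K(3) by eventually_elim (auto simp: indicator_def y_def split: if_splits)
    ultimately have "y k \<in> compactly_supported" using K by (auto simp: compactly_supported_def)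
    then show "\<exists>w\<in>compactly_supported. rho (\<lambda>x. w x - v x) \<le> ennreal e"
      using k by (auto intro: less_imp_le)
  qed (rule v)
qed

lemma W0_closed_ideal: "closedin (W_topology \<Omega> s q p) (W0_space \<Omega> s q p)
    \<and> W_ideal \<Omega> s q p (W0_space \<Omega> s q p)"
proof
  show "closedin (W_topology \<Omega> s q p) (W0_space \<Omega> s q p)"
    unfolding W0_space_def by (rule closedin_closure_of)
  show "W_ideal \<Omega> s q p (W0_space \<Omega> s q p)"
    unfolding W_ideal_def linear_subspace_def
    using W0_subset W0_zero W0_add W0_cmult W0_solid by blast
qed

end

section \<open>From essential bounds to a common exponent bound\<close>

lemma esssup_less_PInf_bounded:
  assumes "esssup M (\<lambda>x. ereal (r x)) < \<infinity>"
  obtains B where "AE x in M. r x \<le> B"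
proof -
  have "esssup M (\<lambda>x. ereal (r x)) \<noteq> \<infinity>" using assms by simp
  \<comment> \<open>A natural number above the essential supremum also covers the value
    \<open>-\<infinity>\<close>.\<close>
  then obtain n :: nat where n: "esssup M (\<lambda>x. ereal (r x)) < ereal (real n)"
    by (auto simp: less_PInf_Ex_of_nat)
  have "AE x in M. r x \<le> real n"
    using esssup_AE[of "\<lambda>x. ereal (r x)" M]
  proof eventually_elim
    case (elim x)
    then have "ereal (r x) < ereal (real n)" using n by (rule le_less_trans)
    then show ?case by simp
  qed
  then show ?thesis by (rule that)
qed

lemma bounded_exponentI:
  assumes "r \<in> exponents M" "AE x in M. r x \<le> B" "B \<le> P"
  shows "bounded_exponent M r P"
proof
  show "AE x in M. r x \<le> P" using assms(2) by eventually_elim (use assms in linarith)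
qed (use assms in \<open>auto simp: exponents_def\<close>)

theorem theorem1p2:
  fixes \<Omega> :: "(real^'n) set" and s :: real
    and q :: "real^'n \<Rightarrow> real" and p :: "(real^'n) \<times> (real^'n) \<Rightarrow> real"
  assumes "open \<Omega>"
    and "0 < s" "s < 1"
    and "q \<in> exponents (lebesgue_on \<Omega>)"
    and "p \<in> exponents (lebesgue_on (\<Omega> \<times> \<Omega>))"
    and "1 < essinf (lebesgue_on \<Omega>) (\<lambda>x. ereal (q x))"
    and "essinf (lebesgue_on \<Omega>) (\<lambda>x. ereal (q x)) \<le> esssup (lebesgue_on \<Omega>) (\<lambda>x. ereal (q x))"
    and "esssup (lebesgue_on \<Omega>) (\<lambda>x. ereal (q x)) < \<infinity>"
    and "1 < essinf (lebesgue_on (\<Omega> \<times> \<Omega>)) (\<lambda>z. ereal (p z))"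
    and "essinf (lebesgue_on (\<Omega> \<times> \<Omega>)) (\<lambda>z. ereal (p z))
          \<le> esssup (lebesgue_on (\<Omega> \<times> \<Omega>)) (\<lambda>z. ereal (p z))"
    and "esssup (lebesgue_on (\<Omega> \<times> \<Omega>)) (\<lambda>z. ereal (p z)) < \<infinity>"
  shows "closedin (W_topology \<Omega> s q p) (W0_space \<Omega> s q p)
    \<and> W_ideal \<Omega> s q p (W0_space \<Omega> s q p)"
proof -
  obtain A where A: "AE x in lebesgue_on \<Omega>. q x \<le> A"
    using assms(8) by (rule esssup_less_PInf_bounded)
  obtain B where B: "AE z in lebesgue_on (\<Omega> \<times> \<Omega>). p z \<le> B"
    using assms(11) by (rule esssup_less_PInf_bounded)
  \<comment> \<open>The larger of the two essential bounds serves as the common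
    \<open>P\<close>.\<close>
  interpret variable_sobolev \<Omega> s q p "max A B"
    by (rule variable_sobolev.intro[OF assms(1)
          bounded_exponentI[OF assms(4) A] bounded_exponentI[OF assms(5) B]]) simp_all
  show ?thesis by (rule W0_closed_ideal)
qed

end
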